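(* Let $X^0$ be a set of mutually nondominated points and let $x_0\in X^0$ be a point such that the set $\mathcal{L}(x_0)=\bigcup_{j=1}^m\{x\in\mathbb{R}^n\mid f_j(x)\le f_j(x_0)\}$ is compact. Let $\{X^k\}$ be the sequence of sets of nondominated points produced by the Front Descent algorithm (described in the context) with $\sigma_k\to0$, implemented so that, at each iteration $k$, the first point to be processed in the for loop over $X^k$ belongs to $\operatorname{argmin}_{x\in X^k}\theta(x)$. Let $\{x^k\}$ be any sequence such that $x^k\in X^k$ for all $k$. Then $\{x^k\}$ admits accumulation points and every accumulation point is Pareto-stationary for the problem $\min_{x\in\mathbb{R}^n}F(x)$.
   Context: Setting. $F=(f_1,\ldots,f_m)^\top:\mathbb{R}^n\to\mathbb{R}^m$ is continuously differentiable. For $u,w\in\mathbb{R}^m$: $u\le w$ means $u_i\le w_i$ for all $i$; $u<w$ means $u_i<w_i$ for all $i$; $u\lneqq w$ means $u\le w$ and $u\ne w$. A point $y$ is dominated by $x$ if $F(x)\lneqq F(y)$. A set of points is mutually nondominated if none of its points is dominated by another one. $\mathbf{1}\in\mathbb{R}^m$ is the all-ones vector. For $x,d\in\mathbb{R}^n$ let $\mathcal{D}(x,d)=\max_{j=1,\ldots,m}\nabla f_j(x)^\top d$. For nonempty $I\subseteq\{1,\ldots,m\}$ let $\theta^I(x)=\min_{d\in\mathbb{R}^n}\max_{j\in I}\nabla f_j(x)^\top d+\frac12\|d\|^2$ and let $v^I(x)$ be the unique minimizer; $\theta$ and $v$ denote $\theta^I$ and $v^I$ for $I=\{1,\ldots,m\}$.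 A common descent direction at $x$ is a direction that is a descent direction at $x$ for every $f_j$. A point $\bar x$ is Pareto-stationary if $\min_d\max_j\nabla f_j(\bar x)^\top d=0$, equivalently $\theta(\bar x)=0$. Front Descent algorithm. Input: a nonempty finite set $X^0$ of mutually nondominated points; $\alpha_0>0$, $\delta\in(0,1)$, $\gamma\in(0,1)$, $\Gamma_1>0$, $\Gamma_2>0$, a sequence $\{\sigma_k\}\subseteq\mathbb{R}_+$ (nonnegative reals). The algorithm is run without stopping, producing an infinite sequence $\{X^k\}$. At iteration $k=0,1,\ldots$: set $\hat X^k=X^k$; then, sequentially for all $x_c\in X^k$, if $x_c\in\hat X^k$ at that moment, process $x_c$ as follows. (1) Refinement. If $\theta(x_c)<-\sigma_k$: compute a common descent direction $v_D(x_c)$ (arbitrary); if both $\mathcal{D}(x_c,v_D(x_c))\le-\Gamma_1\|v(x_c)\|^2$ and $\|v_D(x_c)\|\le\Gamma_2\|v(x_c)\|$, set $d_c=v_D(x_c)$, otherwise set $d_c=v(x_c)$; set $\alpha_c^k=\max_{h\in\mathbb{N}}\{\alpha_0\delta^h\mid F(x_c+\alpha_0\delta^hd_c)\le F(x_c)+\mathbf{1}\gamma\alpha_0\delta^h\mathcal{D}(x_c,d_c)\}$. Otherwise (if $\theta(x_c)\ge-\sigma_k$) set $d_c=v(x_c)$, $\alpha_c^k=0$. In both cases set $z_c^k=x_c+\alpha_c^kd_c$ and update $\hat X^k\leftarrow\hat X^k\setminus\{y\in\hat X^k\mid F(z_c^k)\lneqq F(y)\}\cup\{z_c^k\}$. (2)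 Exploration. For every nonempty proper subset $I\subsetneq\{1,\ldots,m\}$ with $\theta^I(z_c^k)<0$: if $z_c^k\in\hat X^k$ at that moment, set $\alpha_c^I=\max_{h\in\mathbb{N}}\{\alpha_0\delta^h\mid\forall y\in\hat X^k\ \exists j:\ f_j(z_c^k+\alpha_0\delta^hv^I(z_c^k))<f_j(y)\}$, let $w=z_c^k+\alpha_c^Iv^I(z_c^k)$ and update $\hat X^k\leftarrow\hat X^k\setminus\{y\in\hat X^k\mid F(w)\lneqq F(y)\}\cup\{w\}$. After all points have been considered, set $X^{k+1}=\hat X^k$. *)

theory Defs
  imports "HOL-Analysis.Analysis"
begin

text \<open>
  The order on \<open>real ^ 'm\<close> is the componentwise one of the library.  Its strict part \<open><\<close> is
  dominance (\<open>\<le>\<close> and \<open>\<noteq>\<close>), not componentwise strictness; dominance is spelled out below to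
  avoid any confusion.
\<close>

definition dominates :: "('a \<Rightarrow> real ^ 'm) \<Rightarrow> 'a \<Rightarrow> 'a \<Rightarrow> bool" where
  "dominates F x y \<longleftrightarrow> F x \<le> F y \<and> F x \<noteq> F y"

definition mutually_nondominated :: "('a \<Rightarrow> real ^ 'm) \<Rightarrow> 'a set \<Rightarrow> bool" where
  "mutually_nondominated F X \<longleftrightarrow> (\<forall>x\<in>X. \<forall>y\<in>X. \<not> dominates F x y)"

definition grad :: "(real ^ 'n \<Rightarrow> real) \<Rightarrow> real ^ 'n \<Rightarrow> real ^ 'n" where
  "grad f x = (THE g. GDERIV f x :> g)"

definition continuously_differentiable :: "(real ^ 'n \<Rightarrow> real ^ 'm) \<Rightarrow> bool" where
  "continuously_differentiable F \<longleftrightarrow>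
     F differentiable_on UNIV \<and> (\<forall>j. continuous_on UNIV (grad (\<lambda>x. F x $ j)))"

text \<open>\<open>max_slope F UNIV x d\<close> is \<open>\<D>(x, d)\<close>.\<close>

definition max_slope :: "(real ^ 'n \<Rightarrow> real ^ 'm) \<Rightarrow> 'm set \<Rightarrow> real ^ 'n \<Rightarrow> real ^ 'n \<Rightarrow> real" where
  "max_slope F I x d = Max ((\<lambda>j. grad (\<lambda>y. F y $ j) x \<bullet> d) ` I)"

definition theta :: "(real ^ 'n \<Rightarrow> real ^ 'm) \<Rightarrow> 'm set \<Rightarrow> real ^ 'n \<Rightarrow> real" where
  "theta F I x = (INF d. max_slope F I x d + (norm d)\<^sup>2 / 2)"

definition steepest :: "(real ^ 'n \<Rightarrow> real ^ 'm) \<Rightarrow> 'm set \<Rightarrow> real ^ 'n \<Rightarrow> real ^ 'n" where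
  "steepest F I x =
     (THE v. is_arg_min (\<lambda>d. max_slope F I x d + (norm d)\<^sup>2 / 2) (\<lambda>_. True) v)"

text \<open>
  The minimum need not exist in general, so ``the minimum is 0'' is stated as ``a minimizer exists
  and has value 0''; a real-valued \<open>INF\<close> would be unspecified for the unbounded case.
\<close>

definition pareto_stationary :: "(real ^ 'n \<Rightarrow> real ^ 'm) \<Rightarrow> real ^ 'n \<Rightarrow> bool" where
  "pareto_stationary F x \<longleftrightarrow>
     (\<exists>d. is_arg_min (max_slope F UNIV x) (\<lambda>_. True) d \<and> max_slope F UNIV x d = 0)"

definition descent_direction :: "(real ^ 'n \<Rightarrow> real) \<Rightarrow> real ^ 'n \<Rightarrow> real ^ 'n \<Rightarrow> bool" where
  "descent_direction f x d \<longleftrightarrow> (\<exists>T>0. \<forall>t\<in>{0<..T}. f (x + t *\<^sub>R d) < f x)"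

definition common_descent_direction ::
    "(real ^ 'n \<Rightarrow> real ^ 'm) \<Rightarrow> real ^ 'n \<Rightarrow> real ^ 'n \<Rightarrow> bool" where
  "common_descent_direction F x d \<longleftrightarrow> (\<forall>j. descent_direction (\<lambda>y. F y $ j) x d)"

definition backtracking_step :: "real \<Rightarrow> real \<Rightarrow> (real \<Rightarrow> bool) \<Rightarrow> real" where
  "backtracking_step \<alpha>\<^sub>0 \<delta> P = (GREATEST \<alpha>. \<exists>h::nat. \<alpha> = \<alpha>\<^sub>0 * \<delta> ^ h \<and> P \<alpha>)"

definition insert_point ::
    "(real ^ 'n \<Rightarrow> real ^ 'm) \<Rightarrow> real ^ 'n \<Rightarrow> (real ^ 'n) set \<Rightarrow> (real ^ 'n) set" where
  "insert_point F z Y = (Y - {y \<in> Y. dominates F z y}) \<union> {z}"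

text \<open>
  The common descent direction \<open>v\<^sub>D\<close> is an arbitrary input, so refinement is a relation between the
  processed point \<open>x\<close> and the refined point \<open>z\<close>; \<open>s\<close> is the current tolerance \<open>\<sigma>\<^sub>k\<close>.
\<close>

definition refinement ::
    "(real ^ 'n \<Rightarrow> real ^ 'm) \<Rightarrow> real \<Rightarrow> real \<Rightarrow> real \<Rightarrow> real \<Rightarrow> real \<Rightarrow> real \<Rightarrow>
     real ^ 'n \<Rightarrow> real ^ 'n \<Rightarrow> bool" where
  "refinement F \<alpha>\<^sub>0 \<delta> \<gamma> \<Gamma>\<^sub>1 \<Gamma>\<^sub>2 s x z \<longleftrightarrow>
     (\<exists>d \<alpha>. z = x + \<alpha> *\<^sub>R d \<and>
       (if theta F UNIV x < - s then
          (\<exists>v\<^sub>D. common_descent_direction F x v\<^sub>D \<and>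
             d = (if max_slope F UNIV x v\<^sub>D \<le> - \<Gamma>\<^sub>1 * (norm (steepest F UNIV x))\<^sup>2 \<and>
                     norm v\<^sub>D \<le> \<Gamma>\<^sub>2 * norm (steepest F UNIV x)
                  then v\<^sub>D else steepest F UNIV x)) \<and>
          \<alpha> = backtracking_step \<alpha>\<^sub>0 \<delta>
                (\<lambda>a. F (x + a *\<^sub>R d) \<le> F x + vec (\<gamma> * a * max_slope F UNIV x d))
        else d = steepest F UNIV x \<and> \<alpha> = 0))"

definition explore_step ::
    "(real ^ 'n \<Rightarrow> real ^ 'm) \<Rightarrow> real \<Rightarrow> real \<Rightarrow> real ^ 'n \<Rightarrow> 'm set \<Rightarrow>
     (real ^ 'n) set \<Rightarrow> (real ^ 'n) set" where
  "explore_step F \<alpha>\<^sub>0 \<delta> z I Y =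
     (if z \<in> Y then
        let v = steepest F I z;
            \<alpha> = backtracking_step \<alpha>\<^sub>0 \<delta> (\<lambda>a. \<forall>y\<in>Y. \<exists>j. F (z + a *\<^sub>R v) $ j < F y $ j)
        in insert_point F (z + \<alpha> *\<^sub>R v) Y
      else Y)"

text \<open>
  One pass of the loop body for the point \<open>x\<close>, turning the current set \<open>Y\<close> into \<open>Y'\<close>.  The list
  \<open>Is\<close> is an arbitrary enumeration of the index sets to be explored.
\<close>

definition process_point ::
    "(real ^ 'n \<Rightarrow> real ^ 'm) \<Rightarrow> real \<Rightarrow> real \<Rightarrow> real \<Rightarrow> real \<Rightarrow> real \<Rightarrow> real \<Rightarrow>
     real ^ 'n \<Rightarrow> (real ^ 'n) set \<Rightarrow> (real ^ 'n) set \<Rightarrow> bool" where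
  "process_point F \<alpha>\<^sub>0 \<delta> \<gamma> \<Gamma>\<^sub>1 \<Gamma>\<^sub>2 s x Y Y' \<longleftrightarrow>
     (if x \<in> Y then
        (\<exists>z Is. refinement F \<alpha>\<^sub>0 \<delta> \<gamma> \<Gamma>\<^sub>1 \<Gamma>\<^sub>2 s x z \<and>
           distinct Is \<and> set Is = {I. I \<noteq> {} \<and> I \<subset> UNIV \<and> theta F I z < 0} \<and>
           Y' = fold (explore_step F \<alpha>\<^sub>0 \<delta> z) Is (insert_point F z Y))
      else Y' = Y)"

primrec process_points ::
    "(real ^ 'n \<Rightarrow> real ^ 'm) \<Rightarrow> real \<Rightarrow> real \<Rightarrow> real \<Rightarrow> real \<Rightarrow> real \<Rightarrow> real \<Rightarrow>
     (real ^ 'n) list \<Rightarrow> (real ^ 'n) set \<Rightarrow> (real ^ 'n) set \<Rightarrow> bool" where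
  "process_points F \<alpha>\<^sub>0 \<delta> \<gamma> \<Gamma>\<^sub>1 \<Gamma>\<^sub>2 s [] Y Y' \<longleftrightarrow> Y' = Y"
| "process_points F \<alpha>\<^sub>0 \<delta> \<gamma> \<Gamma>\<^sub>1 \<Gamma>\<^sub>2 s (x # xs) Y Y' \<longleftrightarrow>
     (\<exists>Z. process_point F \<alpha>\<^sub>0 \<delta> \<gamma> \<Gamma>\<^sub>1 \<Gamma>\<^sub>2 s x Y Z \<and> process_points F \<alpha>\<^sub>0 \<delta> \<gamma> \<Gamma>\<^sub>1 \<Gamma>\<^sub>2 s xs Z Y')"

text \<open>The list \<open>xs\<close> is the order in which the points of \<open>X\<close> are visited by the for loop.\<close>

definition front_descent_iteration ::
    "(real ^ 'n \<Rightarrow> real ^ 'm) \<Rightarrow> real \<Rightarrow> real \<Rightarrow> real \<Rightarrow> real \<Rightarrow> real \<Rightarrow> real \<Rightarrow>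
     (real ^ 'n) list \<Rightarrow> (real ^ 'n) set \<Rightarrow> (real ^ 'n) set \<Rightarrow> bool" where
  "front_descent_iteration F \<alpha>\<^sub>0 \<delta> \<gamma> \<Gamma>\<^sub>1 \<Gamma>\<^sub>2 s xs X X' \<longleftrightarrow>
     distinct xs \<and> set xs = X \<and> process_points F \<alpha>\<^sub>0 \<delta> \<gamma> \<Gamma>\<^sub>1 \<Gamma>\<^sub>2 s xs X X'"

definition accumulation_point :: "(nat \<Rightarrow> 'a::topological_space) \<Rightarrow> 'a \<Rightarrow> bool" where
  "accumulation_point x l \<longleftrightarrow> (\<exists>r::nat \<Rightarrow> nat. strict_mono r \<and> (x \<circ> r) \<longlonglongrightarrow> l)"

end

theory Submission
  imports Defs
begin

text \<open>
  Suppose \<open>\<theta> p\<^sub>k \<le> -\<epsilon>\<close> for infinitely many first-processed points \<open>p\<^sub>k\<close>.  All iterates lie in the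
  compact set \<open>\<L>(x\<^sub>0)\<close>, so once \<open>\<sigma>\<^sub>k < \<epsilon>\<close> the Armijo search takes steps bounded below and the refined
  point \<open>z\<^sub>k\<close> satisfies \<open>F z\<^sub>k \<le> F p\<^sub>k - c\<close> componentwise for a fixed \<open>c > 0\<close>.  Every later front
  contains a point at least as good as \<open>z\<^sub>k\<close> and is mutually nondominated, so each later \<open>p\<^sub>l\<close> has a
  component with \<open>F\<^sub>j p\<^sub>l \<le> F\<^sub>j p\<^sub>k - c\<close>.  The images of these points are thus pairwise \<open>c\<close>-separated in
  a compact set, which is absurd.  Hence \<open>\<theta> p\<^sub>k\<close>, and by minimality \<open>\<theta> x\<^sub>k\<close>, tends to \<open>0\<close>, and \<open>\<theta>\<close>,
  an infimum of continuous functions, is upper semicontinuous.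
\<close>

section \<open>Gradients and limits of finite maxima\<close>

lemma GDERIV_grad:
  fixes f :: "real ^ 'n \<Rightarrow> real"
  assumes "f differentiable at x"
  shows "GDERIV f x :> grad f x"
proof -
  obtain f' where f': "(f has_derivative f') (at x)"
    using assms by (auto simp: differentiable_def)
  \<comment> \<open>The adjoint at \<open>1\<close> is the vector representing the linear functional
    \<open>f'\<close>.\<close>
  have "f' = (\<lambda>h. h \<bullet> adjoint f' 1)"
    using adjoint_works[OF has_derivative_linear[OF f'], of _ 1] by auto
  with f' have g: "GDERIV f x :> adjoint f' 1"
    unfolding gderiv_def by (rule has_derivative_eq_rhs)
  \<comment> \<open>\<open>grad\<close> is a definite description, so existence has to be paired
    with uniqueness.\<close>
  moreover have "g = adjoint f' 1" if "GDERIV f x :> g" for g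
  proof -
    have "h \<bullet> g = h \<bullet> adjoint f' 1" for h
      using has_derivative_unique[OF that[unfolded gderiv_def] g[unfolded gderiv_def]]
      by (rule fun_cong)
    then show ?thesis
      by (rule vector_eq_ldot[THEN iffD1, OF allI])
  qed
  ultimately show ?thesis
    unfolding grad_def by (rule theI)
qed

lemma continuously_differentiable_GDERIV:
  assumes "continuously_differentiable F"
  shows "GDERIV (\<lambda>x. F x $ j) x :> grad (\<lambda>x. F x $ j) x"
proof (rule GDERIV_grad)
  obtain F' where "(F has_derivative F') (at x)"
    using assms
    by (auto simp: continuously_differentiable_def differentiable_on_def differentiable_def)
  from bounded_linear.has_derivative[OF bounded_linear_vec_nth this]
  show "(\<lambda>x. F x $ j) differentiable at x"
    by (rule differentiableI)
qed

lemma tendsto_Max: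
  fixes f :: "'i \<Rightarrow> 'a \<Rightarrow> 'b::linorder_topology"
  assumes "finite I" "I \<noteq> {}" "\<And>i. i \<in> I \<Longrightarrow> (f i \<longlongrightarrow> l i) A"
  shows "((\<lambda>x. Max ((\<lambda>i. f i x) ` I)) \<longlongrightarrow> Max (l ` I)) A"
  using assms
proof (induction I rule: finite_ne_induct)
  case (insert i I)
  have "((\<lambda>x. max (f i x) (Max ((\<lambda>i. f i x) ` I))) \<longlongrightarrow> max (l i) (Max (l ` I))) A"
    using insert by (intro tendsto_max) auto
  with insert.hyps show ?case
    by simp
qed simp

subsection \<open>The steepest descent model\<close>

lemma max_slope_ge:
  fixes F :: "real ^ 'n \<Rightarrow> real ^ 'm"
  assumes "j \<in> I"
  shows "grad (\<lambda>y. F y $ j) x \<bullet> d \<le> max_slope F I x d"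
  unfolding max_slope_def using assms by (intro Max_ge) auto

lemma max_slope_le_iff:
  fixes F :: "real ^ 'n \<Rightarrow> real ^ 'm"
  assumes "I \<noteq> {}"
  shows "max_slope F I x d \<le> c \<longleftrightarrow> (\<forall>j\<in>I. grad (\<lambda>y. F y $ j) x \<bullet> d \<le> c)"
  unfolding max_slope_def using assms by (subst Max_le_iff) auto

lemma max_slope_zero [simp]:
  fixes F :: "real ^ 'n \<Rightarrow> real ^ 'm"
  assumes "I \<noteq> {}"
  shows "max_slope F I x 0 = 0"
  using assms by (simp add: max_slope_def)

lemma max_slope_scaleR:
  fixes F :: "real ^ 'n \<Rightarrow> real ^ 'm"
  assumes "I \<noteq> {}" "0 \<le> t"
  shows "max_slope F I x (t *\<^sub>R d) \<le> t * max_slope F I x d"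
  using assms by (auto simp: max_slope_le_iff intro!: mult_left_mono max_slope_ge)

text \<open>The objective shared by \<open>theta\<close> and \<open>steepest\<close>: the first is
  its infimum, the second its minimizer.\<close>

definition descent_model ::
    "(real ^ 'n \<Rightarrow> real ^ 'm) \<Rightarrow> 'm set \<Rightarrow> real ^ 'n \<Rightarrow> real ^ 'n \<Rightarrow> real" where
  "descent_model F I x d = max_slope F I x d + (norm d)\<^sup>2 / 2"

text \<open>Joint continuity serves twice: with \<open>x\<close> constant it helps to find a
  minimizer, with \<open>d\<close> constant it gives upper semicontinuity of
  \<open>theta\<close>.\<close>

lemma tendsto_descent_model:
  fixes F :: "real ^ 'n \<Rightarrow> real ^ 'm"
  assumes F: "continuously_differentiable F" and I: "I \<noteq> {}"
    and "(x \<longlongrightarrow> a) A" "(d \<longlongrightarrow> b) A"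
  shows "((\<lambda>k. descent_model F I (x k) (d k)) \<longlongrightarrow> descent_model F I a b) A"
proof -
  have "((\<lambda>k. grad (\<lambda>y. F y $ j) (x k)) \<longlongrightarrow> grad (\<lambda>y. F y $ j) a) A" for j
    using F assms(3) isCont_tendsto_compose
    by (fastforce simp: continuously_differentiable_def continuous_on_eq_continuous_at)
  then show ?thesis
    unfolding descent_model_def max_slope_def
    using I assms(4) by (intro tendsto_intros tendsto_Max) auto
qed

text \<open>Completing the square in the slope of a single component. The bound is independent of
  \<open>d\<close>, so the real-valued \<open>INF\<close> in \<open>theta\<close> is a genuine
  infimum.\<close>

lemma descent_model_lower:
  fixes F :: "real ^ 'n \<Rightarrow> real ^ 'm"
  assumes "j \<in> I"
  shows "- (norm (grad (\<lambda>y. F y $ j) x))\<^sup>2 / 2 \<le> descent_model F I x d"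
proof -
  let ?g = "grad (\<lambda>y. F y $ j) x"
  have "0 \<le> (norm (?g + d))\<^sup>2 / 2"
    by simp
  also have "\<dots> = (norm ?g)\<^sup>2 / 2 + (?g \<bullet> d + (norm d)\<^sup>2 / 2)"
    by (simp add: power2_norm_eq_inner inner_add_left inner_add_right inner_commute field_simps)
  finally show ?thesis
    using max_slope_ge[OF assms, of F x d] by (simp add: descent_model_def)
qed

lemma theta_le:
  fixes F :: "real ^ 'n \<Rightarrow> real ^ 'm"
  assumes "I \<noteq> {}"
  shows "theta F I x \<le> descent_model F I x d"
proof -
  obtain j where "j \<in> I" using assms by blast
  then have "bdd_below (range (descent_model F I x))"
    by (intro bdd_belowI2[OF descent_model_lower])
  then show ?thesis
    unfolding theta_def descent_model_def[symmetric] by (intro cINF_lower) auto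
qed

lemma theta_nonpos:
  fixes F :: "real ^ 'n \<Rightarrow> real ^ 'm"
  assumes "I \<noteq> {}"
  shows "theta F I x \<le> 0"
  using theta_le[OF assms, of F x 0] assms by (simp add: descent_model_def)

text \<open>Strong convexity: a maximum of linear functions is convex, and the parallelogram
  identity supplies the quadratic deficit.\<close>

lemma descent_model_midpoint:
  fixes F :: "real ^ 'n \<Rightarrow> real ^ 'm"
  assumes "I \<noteq> {}"
  shows "descent_model F I x ((1/2) *\<^sub>R (u + w))
    \<le> (descent_model F I x u + descent_model F I x w) / 2 - (norm (u - w))\<^sup>2 / 8"
proof -
  have "max_slope F I x ((1/2) *\<^sub>R (u + w)) \<le> (max_slope F I x u + max_slope F I x w) / 2"
    unfolding max_slope_le_iff[OF assms]
    using max_slope_ge[of _ I F x u] max_slope_ge[of _ I F x w]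
    by (auto simp: inner_add_right intro: add_mono)
  moreover have "(norm ((1/2) *\<^sub>R (u + w)))\<^sup>2 / 2
      = ((norm u)\<^sup>2 / 2 + (norm w)\<^sup>2 / 2) / 2 - (norm (u - w))\<^sup>2 / 8"
    unfolding power2_norm_eq_inner
    by (simp add: inner_add_left inner_add_right inner_diff_left inner_diff_right
        inner_commute field_simps)
  ultimately show ?thesis
    unfolding descent_model_def by argo
qed

text \<open>Coercivity: outside the ball of radius \<open>2 * norm g\<close> the model is
  nonnegative, while it vanishes at the origin. A minimizer over this compact ball is therefore
  global.\<close>

lemma descent_model_attains_min:
  fixes F :: "real ^ 'n \<Rightarrow> real ^ 'm"
  assumes F: "continuously_differentiable F" and I: "I \<noteq> {}"
  obtains v where "\<And>d. descent_model F I x v \<le> descent_model F I x d"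
proof -
  obtain j where j: "j \<in> I" using I by blast
  define g where "g = grad (\<lambda>y. F y $ j) x"
  have "continuous_on UNIV (descent_model F I x)"
    unfolding continuous_on_def using F I by (intro ballI tendsto_descent_model) auto
  then have "\<exists>v\<in>cball 0 (2 * norm g). \<forall>d\<in>cball 0 (2 * norm g).
      descent_model F I x v \<le> descent_model F I x d"
    by (intro continuous_attains_inf) (auto intro: continuous_on_subset)
  then obtain v where
    v: "\<And>d. norm d \<le> 2 * norm g \<Longrightarrow> descent_model F I x v \<le> descent_model F I x d"
    by (metis mem_cball_0)
  have "descent_model F I x v \<le> descent_model F I x d" if "2 * norm g < norm d" for d
  proof -
    have "descent_model F I x v \<le> 0"
      using v[of 0] I by (simp add: descent_model_def)
    also have "0 \<le> norm d * (norm d / 2 - norm g)"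
      using that by (intro mult_nonneg_nonneg) auto
    also have "\<dots> \<le> g \<bullet> d + (norm d)\<^sup>2 / 2"
      using Cauchy_Schwarz_ineq2[of g d] by (simp add: field_simps power2_eq_square)
    also have "\<dots> \<le> descent_model F I x d"
      using max_slope_ge[OF j, of F x d] by (simp add: descent_model_def g_def)
    finally show ?thesis .
  qed
  with v show thesis
    by (metis that not_le)
qed

text \<open>The midpoint of two distinct minimizers would have a smaller value, so the minimizer is
  unique and the definite description in \<open>steepest\<close> denotes it.\<close>

lemma theta_eq_descent_model_steepest:
  fixes F :: "real ^ 'n \<Rightarrow> real ^ 'm"
  assumes F: "continuously_differentiable F" and I: "I \<noteq> {}"
  shows "theta F I x = descent_model F I x (steepest F I x)"
proof -
  let ?q = "descent_model F I x"
  obtain v where v: "\<And>d. ?q v \<le> ?q d"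
    using descent_model_attains_min[OF assms] by blast
  have "u = v" if "\<And>d. ?q u \<le> ?q d" for u
  proof (rule ccontr)
    assume "u \<noteq> v"
    then have "0 < (norm (u - v))\<^sup>2"
      by simp
    moreover have "?q u = ?q v"
      using v that by (simp add: antisym)
    ultimately show False
      using descent_model_midpoint[OF I, of F x u v] v[of "(1/2) *\<^sub>R (u + v)"] by argo
  qed
  then have "steepest F I x = v"
    unfolding steepest_def descent_model_def[symmetric] is_arg_min_linorder
    using v by (intro the_equality) auto
  moreover have "theta F I x = ?q v"
    unfolding theta_def descent_model_def[symmetric]
    using v by (intro cInf_eq_minimum) auto
  ultimately show ?thesis by simp
qed

lemma max_slope_steepest_le:
  fixes F :: "real ^ 'n \<Rightarrow> real ^ 'm"
  assumes "continuously_differentiable F" "I \<noteq> {}"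
  shows "max_slope F I x (steepest F I x) \<le> theta F I x"
  by (simp add: theta_eq_descent_model_steepest[OF assms] descent_model_def)

text \<open>The quadratic term is of second order: evaluating the model at
  \<open>t *\<^sub>R d\<close>, dividing by \<open>t\<close> and letting \<open>t\<close> tend to 0
  leaves only the slope. The zero direction then attains the minimum 0.\<close>

lemma pareto_stationary_if_theta_nonneg:
  fixes F :: "real ^ 'n \<Rightarrow> real ^ 'm"
  assumes "0 \<le> theta F UNIV x"
  shows "pareto_stationary F x"
proof -
  have "0 \<le> max_slope F UNIV x d" for d
  proof (rule tendsto_lowerbound)
    let ?f = "\<lambda>t. max_slope F UNIV x d + t * (norm d)\<^sup>2 / 2"
    show "(?f \<longlongrightarrow> max_slope F UNIV x d) (at_right 0)"
      by (auto intro!: tendsto_eq_intros)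
    have "0 \<le> ?f t" if "0 < t" for t
    proof -
      have "0 \<le> descent_model F UNIV x (t *\<^sub>R d)"
        using assms theta_le[of UNIV F x] by (rule order_trans) auto
      also have "\<dots> \<le> t * ?f t"
        using max_slope_scaleR[of UNIV t F x d] that
        by (simp add: descent_model_def power2_eq_square algebra_simps)
      finally show ?thesis
        using that by (simp add: zero_le_mult_iff)
    qed
    then show "\<forall>\<^sub>F t in at_right 0. 0 \<le> ?f t"
      by (auto simp: eventually_at_right_field intro: exI[of _ 1])
  qed auto
  then show ?thesis
    unfolding pareto_stationary_def is_arg_min_linorder
    by (intro exI[of _ 0]) simp
qed

subsection \<open>Line searches\<close>

text \<open>By the mean value theorem the increment along \<open>d\<close> is governed by the
  gradient at an intermediate point. Uniform continuity on a ball containing all the segments keeps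
  it close to the gradient at \<open>x\<close>, so one \<open>T\<close> serves all points and
  directions.\<close>

lemma armijo_uniform:
  fixes F :: "real ^ 'n \<Rightarrow> real ^ 'm"
  assumes F: "continuously_differentiable F" and L: "bounded L" and c: "0 < c" and \<gamma>: "\<gamma> < 1"
  obtains T where "0 < T"
    and "\<And>I x d t j. \<lbrakk>x \<in> L; norm d \<le> M; max_slope F I x d \<le> - c; j \<in> I; 0 < t; t \<le> T\<rbrakk>
           \<Longrightarrow> F (x + t *\<^sub>R d) $ j \<le> F x $ j + \<gamma> * t * max_slope F I x d"
proof -
  define G where "G x = (\<chi> j. grad (\<lambda>y. F y $ j) x)" for x
  \<comment> \<open>\<open>M\<close> may be nonpositive, while \<open>\<epsilon>\<close> and
    \<open>T\<close> below divide by the radius.\<close>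
  define M' where "M' = max 1 M"
  have M': "M' > 0" "M \<le> M'" by (auto simp: M'_def)
  obtain R where R: "\<And>x. x \<in> L \<Longrightarrow> norm x \<le> R"
    using L by (auto simp: bounded_iff)
  have "continuous_on UNIV G"
    unfolding G_def using F
    by (intro continuous_on_vec_lambda) (auto simp: continuously_differentiable_def)
  then have "uniformly_continuous_on (cball 0 (R + M')) G"
    by (intro compact_uniformly_continuous) (auto intro: continuous_on_subset)
  \<comment> \<open>Makes \<open>M' * \<epsilon>\<close> equal to \<open>(1 - \<gamma>) * c\<close>,
    the least slack between a slope of at most \<open>- c\<close> and its fraction
    \<open>\<gamma>\<close>.\<close>
  moreover define \<epsilon> where "\<epsilon> = (1 - \<gamma>) * c / M'"
  have "\<epsilon> > 0" using c \<gamma> M' by (simp add: \<epsilon>_def)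
  ultimately obtain \<eta> where \<eta>: "\<eta> > 0" and
    unif: "\<And>x y. \<lbrakk>norm x \<le> R + M'; norm y \<le> R + M'; dist y x < \<eta>\<rbrakk> \<Longrightarrow> dist (G y) (G x) < \<epsilon>"
    unfolding uniformly_continuous_on_def by (metis mem_cball_0)
  \<comment> \<open>The bound 1 keeps the segment inside the ball of radius \<open>R + M'\<close>;
    the other makes the displacement smaller than \<open>\<eta>\<close>.\<close>
  define T where "T = min 1 (\<eta> / (2 * M'))"
  show thesis
  proof (rule that[of T])
    show "0 < T" using \<eta> M' by (simp add: T_def)
    fix I x d t j
    assume x: "x \<in> L" and d: "norm d \<le> M" and D: "max_slope F I x d \<le> - c"
      and j: "j \<in> I" and t: "0 < t" "t \<le> T"
    let ?g = "grad (\<lambda>y. F y $ j)"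
    have "((\<lambda>s. F (x + s *\<^sub>R d) $ j) has_derivative (\<lambda>h. (h *\<^sub>R d) \<bullet> ?g (x + s *\<^sub>R d))) (at s within {0..t})"
      for s
    proof -
      have "((\<lambda>s. x + s *\<^sub>R d) has_derivative (\<lambda>h. h *\<^sub>R d)) (at s within {0..t})"
        by (auto intro!: derivative_eq_intros)
      from has_derivative_compose[OF this
          continuously_differentiable_GDERIV[OF F, of j, unfolded gderiv_def]]
      show ?thesis .
    qed
    from mvt_simple[OF t(1) this] obtain s where s: "0 < s" "s < t"
      and eq: "F (x + t *\<^sub>R d) $ j - F x $ j = t * (d \<bullet> ?g (x + s *\<^sub>R d))"
      by auto
    have sd: "norm (s *\<^sub>R d) \<le> s * M'"
      using s d M' by (auto intro!: mult_left_mono)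
    have "s \<le> 1"
      using s t by (simp add: T_def)
    have "s * M' < t * M'"
      using s M' by (intro mult_strict_right_mono)
    also have "\<dots> < \<eta>"
      using t M' \<eta> by (simp add: T_def field_simps)
    finally have "s * M' < \<eta>" .
    with \<open>s \<le> 1\<close> have "norm (s *\<^sub>R d) \<le> M'" "norm (s *\<^sub>R d) < \<eta>"
      using sd M' mult_right_mono[of s 1 M'] by linarith+
    then have "dist (G (x + s *\<^sub>R d)) (G x) < \<epsilon>"
      using R[OF x] M' norm_triangle_ineq[of x "s *\<^sub>R d"]
      by (intro unif) (auto simp: dist_norm simp del: norm_scaleR)
    then have "norm ((G (x + s *\<^sub>R d) - G x) $ j) \<le> \<epsilon>"
      using Finite_Cartesian_Product.norm_nth_le[of "G (x + s *\<^sub>R d) - G x" j]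
      unfolding dist_norm by linarith
    then have le_\<epsilon>: "norm (?g (x + s *\<^sub>R d) - ?g x) \<le> \<epsilon>"
      by (simp add: G_def)
    have "d \<bullet> (?g (x + s *\<^sub>R d) - ?g x) \<le> norm d * norm (?g (x + s *\<^sub>R d) - ?g x)"
      by (rule norm_cauchy_schwarz)
    also have "\<dots> \<le> M' * \<epsilon>"
      using d M' le_\<epsilon> by (intro mult_mono) auto
    also have "\<dots> = (1 - \<gamma>) * c"
      using M' by (simp add: \<epsilon>_def)
    also have "\<dots> \<le> (1 - \<gamma>) * (- max_slope F I x d)"
      using D \<gamma> by (intro mult_left_mono) auto
    finally have "d \<bullet> ?g (x + s *\<^sub>R d) \<le> \<gamma> * max_slope F I x d"
      using max_slope_ge[OF j, of F x d] by (simp add: inner_diff_right inner_commute algebra_simps)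
    then have "t * (d \<bullet> ?g (x + s *\<^sub>R d)) \<le> t * (\<gamma> * max_slope F I x d)"
      using t by (intro mult_left_mono) auto
    then show "F (x + t *\<^sub>R d) $ j \<le> F x $ j + \<gamma> * t * max_slope F I x d"
      using eq by (simp add: mult_ac)
  qed
qed

text \<open>The trial steps decrease to 0, so some are accepted, and \<open>GREATEST\<close> picks
  the one with the least accepted exponent.\<close>

lemma backtracking_step:
  fixes P :: "real \<Rightarrow> bool"
  assumes \<alpha>: "0 < \<alpha>\<^sub>0" and \<delta>: "0 < \<delta>" "\<delta> < 1" and "0 < T"
    and P: "\<And>t. \<lbrakk>0 < t; t \<le> T\<rbrakk> \<Longrightarrow> P t"
  shows "P (backtracking_step \<alpha>\<^sub>0 \<delta> P)" and "min \<alpha>\<^sub>0 (\<delta> * T) \<le> backtracking_step \<alpha>\<^sub>0 \<delta> P"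
proof -
  obtain h where "\<delta> ^ h < T / \<alpha>\<^sub>0"
    using real_arch_pow_inv[of "T / \<alpha>\<^sub>0" \<delta>] assms by auto
  then have h: "P (\<alpha>\<^sub>0 * \<delta> ^ h)"
    using \<alpha> \<delta> by (intro P) (auto simp: field_simps)
  define n where "n = (LEAST h. P (\<alpha>\<^sub>0 * \<delta> ^ h))"
  have n: "P (\<alpha>\<^sub>0 * \<delta> ^ n)"
    unfolding n_def using h by (rule LeastI)
  have least: "n \<le> i" if "P (\<alpha>\<^sub>0 * \<delta> ^ i)" for i
    unfolding n_def using that by (rule Least_le)
  have eq: "backtracking_step \<alpha>\<^sub>0 \<delta> P = \<alpha>\<^sub>0 * \<delta> ^ n"
    unfolding backtracking_step_def
    using n \<alpha> \<delta> by (intro Greatest_equality) (auto dest!: least intro!: power_decreasing)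
  show "P (backtracking_step \<alpha>\<^sub>0 \<delta> P)"
    using n eq by simp
  show "min \<alpha>\<^sub>0 (\<delta> * T) \<le> backtracking_step \<alpha>\<^sub>0 \<delta> P"
  proof (cases n)
    \<comment> \<open>The preceding trial was rejected and hence exceeds \<open>T\<close>; the
      accepted step is smaller by one factor \<open>\<delta>\<close>.\<close>
    case (Suc m)
    then have "\<not> P (\<alpha>\<^sub>0 * \<delta> ^ m)"
      using least[of m] by auto
    then have "T < \<alpha>\<^sub>0 * \<delta> ^ m"
      using P[of "\<alpha>\<^sub>0 * \<delta> ^ m"] \<alpha> \<delta> by (metis mult_pos_pos not_less zero_less_power)
    then have "\<delta> * T \<le> \<delta> * (\<alpha>\<^sub>0 * \<delta> ^ m)"
      using \<delta> by (intro mult_left_mono) auto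
    then show ?thesis
      using eq Suc by (simp add: mult_ac)
  qed (simp add: eq)
qed

subsection \<open>Nondominated sets\<close>

lemma not_dominates_if_less: "F x $ j < F y $ j \<Longrightarrow> \<not> dominates F y x"
  by (metis dominates_def less_eq_vec_def not_le)

text \<open>The loop invariant. Finiteness lets the exploration search meet its conditions, one per
  point, with a common step.\<close>

definition nondominated_front :: "('a \<Rightarrow> real ^ 'm) \<Rightarrow> 'a set \<Rightarrow> bool" where
  "nondominated_front F Y \<longleftrightarrow> finite Y \<and> mutually_nondominated F Y"

text \<open>Points may leave the current set, so progress is tracked by this preorder instead of
  inclusion.\<close>

definition covers :: "('a \<Rightarrow> real ^ 'm) \<Rightarrow> 'a set \<Rightarrow> 'a set \<Rightarrow> bool" where
  "covers F Y Z \<longleftrightarrow> (\<forall>z\<in>Z. \<exists>y\<in>Y. F y \<le> F z)"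

lemma covers_refl [simp]: "covers F Y Y"
  by (auto simp: covers_def)

lemma covers_trans:
  assumes "covers F Y' Y" "covers F Y Z"
  shows "covers F Y' Z"
  unfolding covers_def
proof
  fix z
  assume "z \<in> Z"
  then obtain y where "y \<in> Y" "F y \<le> F z"
    using assms(2) by (auto simp: covers_def)
  moreover from this obtain y' where "y' \<in> Y'" "F y' \<le> F y"
    using assms(1) by (auto simp: covers_def)
  ultimately show "\<exists>y'\<in>Y'. F y' \<le> F z"
    by (blast intro: order_trans)
qed

lemma covers_insert_point: "covers F (insert_point F z Y) Y"
  unfolding covers_def insert_point_def dominates_def by blast

lemma nondominated_front_insert_point:
  assumes "nondominated_front F Y" "\<And>y. y \<in> Y \<Longrightarrow> \<not> dominates F y z"
  shows "nondominated_front F (insert_point F z Y)"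
  using assms
  by (auto simp: nondominated_front_def mutually_nondominated_def insert_point_def dominates_def)

text \<open>Each \<open>y\<close> in \<open>Y\<close> imposes a condition that all small steps
  satisfy: if \<open>F y = F z\<close>, a component in \<open>I\<close> strictly decreases;
  otherwise \<open>z\<close> is strictly better than \<open>y\<close> in some component, which
  persists by continuity. The accepted point is thus dominated by no member of
  \<open>Y\<close>.\<close>

lemma explore_step:
  fixes F :: "real ^ 'n \<Rightarrow> real ^ 'm"
  assumes F: "continuously_differentiable F" and \<alpha>: "0 < \<alpha>\<^sub>0" and \<delta>: "0 < \<delta>" "\<delta> < 1"
    and I: "I \<noteq> {}" and \<theta>: "theta F I z < 0" and Y: "nondominated_front F Y"
  shows "nondominated_front F (explore_step F \<alpha>\<^sub>0 \<delta> z I Y)"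
    and "covers F (explore_step F \<alpha>\<^sub>0 \<delta> z I Y) Y"
proof -
  let ?v = "steepest F I z"
  let ?P = "\<lambda>a. \<forall>y\<in>Y. \<exists>j. F (z + a *\<^sub>R ?v) $ j < F y $ j"
  have "?P (backtracking_step \<alpha>\<^sub>0 \<delta> ?P)" if z: "z \<in> Y"
  proof -
    have "\<forall>\<^sub>F a in at_right 0. \<exists>j. F (z + a *\<^sub>R ?v) $ j < F y $ j" if y: "y \<in> Y" for y
    proof (cases "F z = F y")
      case True
      obtain j where j: "j \<in> I" using I by blast
      define c where "c = - max_slope F I z ?v"
      have c: "0 < c"
        using max_slope_steepest_le[OF F I, of z] \<theta> by (simp add: c_def)
      obtain T where "0 < T" and
        T: "\<And>t. \<lbrakk>0 < t; t \<le> T\<rbrakk> \<Longrightarrow> F (z + t *\<^sub>R ?v) $ j \<le> F z $ j + 1/2 * t * max_slope F I z ?v"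
      \<comment> \<open>The uniform estimate is specialized to the single ray from \<open>z\<close>
        along \<open>?v\<close>; the factor \<open>1/2\<close> retains part of the negative slope,
        which makes the decrease strict.\<close>
      proof (rule armijo_uniform[OF F _ c, of "{z}" "1/2" "norm ?v"])
        fix T
        assume "0 < T" and T: "\<And>I' x d t j.
          \<lbrakk>x \<in> {z}; norm d \<le> norm ?v; max_slope F I' x d \<le> - c; j \<in> I'; 0 < t; t \<le> T\<rbrakk>
           \<Longrightarrow> F (x + t *\<^sub>R d) $ j \<le> F x $ j + 1/2 * t * max_slope F I' x d"
        show thesis
          by (rule that[OF \<open>0 < T\<close>], rule T[where I' = I]) (auto simp: c_def j)
      qed auto
      have "F (z + t *\<^sub>R ?v) $ j < F y $ j" if "0 < t" "t < T" for t
        using T[of t] that c mult_pos_pos[of t c] by (simp add: True c_def)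
      then show ?thesis
        using \<open>0 < T\<close> by (auto simp: eventually_at_right_field)
    next
      case False
      moreover have "\<not> dominates F y z"
        using Y z y by (auto simp: nondominated_front_def mutually_nondominated_def)
      ultimately obtain j where j: "F z $ j < F y $ j"
        by (auto simp: dominates_def less_eq_vec_def not_le)
      have "isCont F z"
        using F differentiable_imp_continuous_within
        by (auto simp: continuously_differentiable_def differentiable_on_def)
      then have "((\<lambda>a. F (z + a *\<^sub>R ?v)) \<longlongrightarrow> F z) (at_right 0)"
        by (rule isCont_tendsto_compose) (auto intro!: tendsto_eq_intros)
      then have "\<forall>\<^sub>F a in at_right 0. F (z + a *\<^sub>R ?v) $ j < F y $ j"
        using j by (intro order_tendstoD(2)[OF tendsto_vec_nth])
      then show ?thesis
        by (rule eventually_mono) auto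
    qed
    then have "eventually ?P (at_right 0)"
      using Y by (intro eventually_ball_finite) (auto simp: nondominated_front_def)
    then obtain b where "b > 0" "\<And>a. \<lbrakk>0 < a; a < b\<rbrakk> \<Longrightarrow> ?P a"
      unfolding eventually_at_right_field by blast
    \<comment> \<open>Halving \<open>b\<close> turns the open interval of good steps into one closed
      at its upper end.\<close>
    then show ?thesis
      by (intro backtracking_step(1)[OF \<alpha> \<delta>, of "b / 2" ?P]) auto
  qed
  then show "nondominated_front F (explore_step F \<alpha>\<^sub>0 \<delta> z I Y)"
    using Y unfolding explore_step_def Let_def
    by (auto intro!: nondominated_front_insert_point dest: not_dominates_if_less)
  show "covers F (explore_step F \<alpha>\<^sub>0 \<delta> z I Y) Y"
    by (simp add: explore_step_def Let_def covers_insert_point)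
qed

lemma fold_explore_step:
  fixes F :: "real ^ 'n \<Rightarrow> real ^ 'm"
  assumes "continuously_differentiable F" "0 < \<alpha>\<^sub>0" "0 < \<delta>" "\<delta> < 1"
    and "\<And>I. I \<in> set Is \<Longrightarrow> I \<noteq> {} \<and> theta F I z < 0" and "nondominated_front F Y"
  shows "nondominated_front F (fold (explore_step F \<alpha>\<^sub>0 \<delta> z) Is Y)
    \<and> covers F (fold (explore_step F \<alpha>\<^sub>0 \<delta> z) Is Y) Y"
  using assms(5,6)
proof (induction Is arbitrary: Y)
  case (Cons I Is)
  let ?Y = "explore_step F \<alpha>\<^sub>0 \<delta> z I Y"
  have Y: "nondominated_front F ?Y" "covers F ?Y Y"
    using explore_step[OF assms(1-4) _ _ Cons.prems(2)] Cons.prems(1)[of I] by auto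
  have "nondominated_front F (fold (explore_step F \<alpha>\<^sub>0 \<delta> z) Is ?Y)
      \<and> covers F (fold (explore_step F \<alpha>\<^sub>0 \<delta> z) Is ?Y) ?Y"
    using Cons.prems(1) by (intro Cons.IH Y(1)) simp
  with covers_trans[OF _ Y(2)] show ?case
    by simp
qed simp

subsection \<open>Sufficient decrease\<close>

text \<open>If \<open>theta\<close> is at most \<open>- \<epsilon>\<close>, compactness bounds the
  norm of the steepest direction from both sides. Either choice of direction is then bounded and has
  slope at most a fixed negative number, so the Armijo step is bounded below and the decrease is
  uniform.\<close>

lemma refinement_gain:
  fixes F :: "real ^ 'n \<Rightarrow> real ^ 'm"
  assumes F: "continuously_differentiable F" and \<alpha>: "0 < \<alpha>\<^sub>0" and \<delta>: "0 < \<delta>" "\<delta> < 1"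
    and \<gamma>: "0 < \<gamma>" "\<gamma> < 1" and \<Gamma>: "0 < \<Gamma>\<^sub>1" "0 < \<Gamma>\<^sub>2" and L: "compact L" and \<epsilon>: "0 < \<epsilon>"
  obtains c where "0 < c"
    and "\<And>s x z. \<lbrakk>x \<in> L; s < \<epsilon>; theta F UNIV x \<le> - \<epsilon>; refinement F \<alpha>\<^sub>0 \<delta> \<gamma> \<Gamma>\<^sub>1 \<Gamma>\<^sub>2 s x z\<rbrakk>
           \<Longrightarrow> F z \<le> F x - vec c"
proof -
  \<comment> \<open>The maximal slope dominates the slope of each component, so the gradient of one
    fixed component yields both norm bounds.\<close>
  obtain j\<^sub>0 :: 'm where True by simp
  let ?g = "grad (\<lambda>y. F y $ j\<^sub>0)"
  have "bounded (?g ` L)"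
    using F L by (intro compact_imp_bounded compact_continuous_image)
      (auto simp: continuously_differentiable_def intro: continuous_on_subset)
  then obtain G where G: "0 < G" "\<And>x. x \<in> L \<Longrightarrow> norm (?g x) \<le> G"
    by (auto simp: bounded_pos)
  \<comment> \<open>\<open>M\<close> bounds both candidate directions: the norm of the steepest one
    is at most \<open>2 * G\<close>, that of an accepted \<open>v\<^sub>D\<close> at most
    \<open>\<Gamma>\<^sub>2\<close> times as much. Likewise \<open>c\<close> is the smaller of the
    two slope guarantees.\<close>
  define M where "M = max 1 \<Gamma>\<^sub>2 * (2 * G)"
  define c where "c = min \<epsilon> (\<Gamma>\<^sub>1 * (\<epsilon> / G)\<^sup>2)"
  have c: "0 < c"
    using \<epsilon> \<Gamma> G by (simp add: c_def)
  obtain T where T: "0 < T" and armijo: "\<And>x d t j.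
      \<lbrakk>x \<in> L; norm d \<le> M; max_slope F UNIV x d \<le> - c; 0 < t; t \<le> T\<rbrakk>
      \<Longrightarrow> F (x + t *\<^sub>R d) $ j \<le> F x $ j + \<gamma> * t * max_slope F UNIV x d"
    using armijo_uniform[OF F compact_imp_bounded[OF L] c \<gamma>(2), of M] by (metis UNIV_I)
  define a where "a = min \<alpha>\<^sub>0 (\<delta> * T)"
  have a: "0 < a" using \<alpha> \<delta> T by (simp add: a_def)
  show thesis
  proof (rule that[of "\<gamma> * a * c"])
    show "0 < \<gamma> * a * c" using \<gamma> a c by simp
    fix s x z
    assume x: "x \<in> L" and s: "s < \<epsilon>" and \<theta>: "theta F UNIV x \<le> - \<epsilon>"
      and "refinement F \<alpha>\<^sub>0 \<delta> \<gamma> \<Gamma>\<^sub>1 \<Gamma>\<^sub>2 s x z"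
    let ?v = "steepest F UNIV x"
    let ?P = "\<lambda>d a. F (x + a *\<^sub>R d) \<le> F x + vec (\<gamma> * a * max_slope F UNIV x d)"
    \<comment> \<open>Since \<open>s < \<epsilon>\<close>, the tolerance test succeeds and the
      search branch is taken.\<close>
    obtain d v\<^sub>D where z: "z = x + backtracking_step \<alpha>\<^sub>0 \<delta> (?P d) *\<^sub>R d"
      and d: "d = (if max_slope F UNIV x v\<^sub>D \<le> - \<Gamma>\<^sub>1 * (norm ?v)\<^sup>2 \<and> norm v\<^sub>D \<le> \<Gamma>\<^sub>2 * norm ?v
                   then v\<^sub>D else ?v)"
      using \<open>refinement F \<alpha>\<^sub>0 \<delta> \<gamma> \<Gamma>\<^sub>1 \<Gamma>\<^sub>2 s x z\<close> s \<theta> by (auto simp: refinement_def)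
    have "- norm (?g x) * norm ?v \<le> ?g x \<bullet> ?v"
      using Cauchy_Schwarz_ineq2[of "?g x" ?v] by simp
    then have "- G * norm ?v + (norm ?v)\<^sup>2 / 2 \<le> theta F UNIV x"
      using max_slope_ge[of j\<^sub>0 UNIV F x ?v] mult_right_mono[OF G(2)[OF x], of "norm ?v"]
      by (simp add: theta_eq_descent_model_steepest[OF F] descent_model_def)
    \<comment> \<open>Dropping \<open>\<epsilon>\<close> gives the upper bound on
      \<open>norm ?v\<close>, dropping the square gives the lower one.\<close>
    then have le: "\<epsilon> + (norm ?v)\<^sup>2 / 2 \<le> G * norm ?v"
      using \<theta> by simp
    then have "norm ?v * norm ?v \<le> 2 * G * norm ?v"
      using \<epsilon> by (simp add: power2_eq_square)
    then have v_le: "norm ?v \<le> 2 * G"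
      using G(1) by (cases "?v = 0") auto
    have "\<epsilon> \<le> G * norm ?v"
      using le by (rule order_trans[rotated]) simp
    then have v_ge: "\<epsilon> / G \<le> norm ?v"
      using G(1) by (simp add: field_simps)
    have "norm d \<le> max 1 \<Gamma>\<^sub>2 * norm ?v"
      using mult_right_mono[of 1 "max 1 \<Gamma>\<^sub>2" "norm ?v"]
        mult_right_mono[of \<Gamma>\<^sub>2 "max 1 \<Gamma>\<^sub>2" "norm ?v"] unfolding d by (auto split: if_splits)
    also have "\<dots> \<le> M"
      unfolding M_def using v_le by (intro mult_left_mono) auto
    finally have dM: "norm d \<le> M" .
    have "\<Gamma>\<^sub>1 * (\<epsilon> / G)\<^sup>2 \<le> \<Gamma>\<^sub>1 * (norm ?v)\<^sup>2"
      using v_ge \<Gamma> \<epsilon> G by (intro mult_left_mono power_mono) auto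
    then have slope: "max_slope F UNIV x d \<le> - c"
      using max_slope_steepest_le[OF F, of UNIV x] \<theta> unfolding d c_def by auto
    have P: "?P d t" if "0 < t" "t \<le> T" for t
      using armijo[OF x dM slope that] by (simp add: less_eq_vec_def)
    define b where "b = backtracking_step \<alpha>\<^sub>0 \<delta> (?P d)"
    have b: "?P d b" "a \<le> b"
      unfolding b_def a_def by (rule backtracking_step[OF \<alpha> \<delta> T P]; assumption)+
    have "a * c \<le> b * (- max_slope F UNIV x d)"
      using b a c slope by (intro mult_mono) auto
    then have "\<gamma> * (a * c) \<le> \<gamma> * (b * (- max_slope F UNIV x d))"
      using \<gamma> by (intro mult_left_mono) auto
    then have "\<gamma> * b * max_slope F UNIV x d \<le> - (\<gamma> * a * c)"
      by (simp add: algebra_simps)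
    moreover have "F z $ j \<le> F x $ j + \<gamma> * b * max_slope F UNIV x d" for j
      using b(1) by (simp add: z b_def less_eq_vec_def)
    ultimately show "F z \<le> F x - vec (\<gamma> * a * c)"
      by (simp add: less_eq_vec_def) (smt (verit))
  qed
qed

text \<open>The uniform gain is applied to the singleton \<open>{x}\<close> with
  \<open>- theta F UNIV x\<close> as threshold; when the tolerance test fails the step is 0 and
  \<open>z = x\<close>.\<close>

lemma refinement_le:
  fixes F :: "real ^ 'n \<Rightarrow> real ^ 'm"
  assumes "continuously_differentiable F" "0 < \<alpha>\<^sub>0" "0 < \<delta>" "\<delta> < 1" "0 < \<gamma>" "\<gamma> < 1"
    and "0 < \<Gamma>\<^sub>1" "0 < \<Gamma>\<^sub>2" and "0 \<le> s" and r: "refinement F \<alpha>\<^sub>0 \<delta> \<gamma> \<Gamma>\<^sub>1 \<Gamma>\<^sub>2 s x z"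
  shows "F z \<le> F x"
proof (cases "theta F UNIV x < - s")
  case True
  then have "0 < - theta F UNIV x"
    using \<open>0 \<le> s\<close> by simp
  from refinement_gain[OF assms(1-8) _ this, of "{x}"]
  obtain c where "0 < c" "F z \<le> F x - vec c"
    using True r by (metis compact_insert compact_empty singletonI minus_minus order_refl
        minus_less_iff)
  then show ?thesis
    by (intro order_trans[OF \<open>F z \<le> F x - vec c\<close>]) (simp add: less_eq_vec_def)
qed (use r in \<open>auto simp: refinement_def\<close>)

section \<open>Effect of an iteration on the front\<close>

lemma process_point:
  fixes F :: "real ^ 'n \<Rightarrow> real ^ 'm"
  assumes ass: "continuously_differentiable F" "0 < \<alpha>\<^sub>0" "0 < \<delta>" "\<delta> < 1" "0 < \<gamma>" "\<gamma> < 1"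
    and \<Gamma>: "0 < \<Gamma>\<^sub>1" "0 < \<Gamma>\<^sub>2" and "0 \<le> s" and Y: "nondominated_front F Y"
    and p: "process_point F \<alpha>\<^sub>0 \<delta> \<gamma> \<Gamma>\<^sub>1 \<Gamma>\<^sub>2 s x Y Y'"
  shows "nondominated_front F Y'" and "covers F Y' Y"
    and "x \<in> Y \<Longrightarrow> \<exists>z. refinement F \<alpha>\<^sub>0 \<delta> \<gamma> \<Gamma>\<^sub>1 \<Gamma>\<^sub>2 s x z \<and> covers F Y' {z}"
proof -
  have "nondominated_front F Y' \<and> covers F Y' Y \<and>
      (\<exists>z. refinement F \<alpha>\<^sub>0 \<delta> \<gamma> \<Gamma>\<^sub>1 \<Gamma>\<^sub>2 s x z \<and> covers F Y' {z})" if x: "x \<in> Y"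
  proof -
    obtain z Is where r: "refinement F \<alpha>\<^sub>0 \<delta> \<gamma> \<Gamma>\<^sub>1 \<Gamma>\<^sub>2 s x z"
      and Is: "set Is = {I. I \<noteq> {} \<and> I \<subset> UNIV \<and> theta F I z < 0}"
      and Y': "Y' = fold (explore_step F \<alpha>\<^sub>0 \<delta> z) Is (insert_point F z Y)"
      using p x by (auto simp: process_point_def)
    have z: "F z \<le> F x"
      using refinement_le[OF ass \<Gamma> \<open>0 \<le> s\<close> r] .
    \<comment> \<open>As \<open>z\<close> is no worse than \<open>x\<close>, a point dominating
      \<open>z\<close> would also dominate \<open>x\<close>, which lies in the nondominated set
      \<open>Y\<close>.\<close>
    have "\<not> dominates F y z" if "y \<in> Y" for y
    proof
      assume "dominates F y z"
      then have "dominates F y x"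
        using z by (auto simp: dominates_def)
      then show False
        using Y x that by (auto simp: nondominated_front_def mutually_nondominated_def)
    qed
    with Y have "nondominated_front F (insert_point F z Y)"
      by (rule nondominated_front_insert_point)
    from fold_explore_step[OF ass(1-4) _ this, of Is z]
    have "nondominated_front F Y'" and cov: "covers F Y' (insert_point F z Y)"
      using Is Y' by auto
    \<comment> \<open>Exploration may delete \<open>z\<close> itself, but a point at least as good
      remains.\<close>
    moreover have "covers F Y' {z}"
      using cov by (auto simp: covers_def insert_point_def)
    ultimately show ?thesis
      using r covers_trans[OF cov covers_insert_point] by blast
  qed
  moreover have "nondominated_front F Y' \<and> covers F Y' Y" if "x \<notin> Y"
    using p Y that by (simp add: process_point_def)
  ultimately show "nondominated_front F Y'" "covers F Y' Y"
    "x \<in> Y \<Longrightarrow> \<exists>z. refinement F \<alpha>\<^sub>0 \<delta> \<gamma> \<Gamma>\<^sub>1 \<Gamma>\<^sub>2 s x z \<and> covers F Y' {z}"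
    by blast+
qed

lemma process_points:
  fixes F :: "real ^ 'n \<Rightarrow> real ^ 'm"
  assumes ass: "continuously_differentiable F" "0 < \<alpha>\<^sub>0" "0 < \<delta>" "\<delta> < 1" "0 < \<gamma>" "\<gamma> < 1"
      "0 < \<Gamma>\<^sub>1" "0 < \<Gamma>\<^sub>2" "0 \<le> s"
    and "nondominated_front F Y" "process_points F \<alpha>\<^sub>0 \<delta> \<gamma> \<Gamma>\<^sub>1 \<Gamma>\<^sub>2 s xs Y Y'"
  shows "nondominated_front F Y' \<and> covers F Y' Y"
  using assms(10-)
proof (induction xs arbitrary: Y)
  case (Cons x xs)
  then obtain Z where Z: "process_point F \<alpha>\<^sub>0 \<delta> \<gamma> \<Gamma>\<^sub>1 \<Gamma>\<^sub>2 s x Y Z"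
    "process_points F \<alpha>\<^sub>0 \<delta> \<gamma> \<Gamma>\<^sub>1 \<Gamma>\<^sub>2 s xs Z Y'"
    by auto
  with Cons.IH[OF _ Z(2)] process_point(1,2)[OF ass Cons.prems(1) Z(1)] show ?case
    using covers_trans by blast
qed simp

text \<open>The first point of the list is certainly refined, because nothing has been removed when
  its turn comes; later points may already be gone. This is where the processing order
  matters.\<close>

lemma front_descent_iteration:
  fixes F :: "real ^ 'n \<Rightarrow> real ^ 'm"
  assumes ass: "continuously_differentiable F" "0 < \<alpha>\<^sub>0" "0 < \<delta>" "\<delta> < 1" "0 < \<gamma>" "\<gamma> < 1"
      "0 < \<Gamma>\<^sub>1" "0 < \<Gamma>\<^sub>2" "0 \<le> s"
    and Y: "nondominated_front F Y"
    and it: "front_descent_iteration F \<alpha>\<^sub>0 \<delta> \<gamma> \<Gamma>\<^sub>1 \<Gamma>\<^sub>2 s xs Y Y'"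
  shows "nondominated_front F Y'" and "covers F Y' Y"
    and "Y \<noteq> {} \<Longrightarrow> \<exists>z. refinement F \<alpha>\<^sub>0 \<delta> \<gamma> \<Gamma>\<^sub>1 \<Gamma>\<^sub>2 s (hd xs) z \<and> covers F Y' {z}"
proof -
  have xs: "set xs = Y" "process_points F \<alpha>\<^sub>0 \<delta> \<gamma> \<Gamma>\<^sub>1 \<Gamma>\<^sub>2 s xs Y Y'"
    using it by (auto simp: front_descent_iteration_def)
  then show "nondominated_front F Y'" "covers F Y' Y"
    using process_points[OF ass Y] by auto
  assume "Y \<noteq> {}"
  then obtain y ys where ys: "xs = y # ys"
    using xs(1) by (cases xs) auto
  then obtain Z where Z: "process_point F \<alpha>\<^sub>0 \<delta> \<gamma> \<Gamma>\<^sub>1 \<Gamma>\<^sub>2 s y Y Z"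
    "process_points F \<alpha>\<^sub>0 \<delta> \<gamma> \<Gamma>\<^sub>1 \<Gamma>\<^sub>2 s ys Z Y'"
    using xs by auto
  have "y \<in> Y"
    using xs(1) ys by auto
  then obtain z where "refinement F \<alpha>\<^sub>0 \<delta> \<gamma> \<Gamma>\<^sub>1 \<Gamma>\<^sub>2 s y z" "covers F Z {z}"
    using process_point(3)[OF ass Y Z(1)] by blast
  moreover have "covers F Y' Z"
    using process_points[OF ass process_point(1)[OF ass Y Z(1)] Z(2)] by blast
  ultimately show "\<exists>z. refinement F \<alpha>\<^sub>0 \<delta> \<gamma> \<Gamma>\<^sub>1 \<Gamma>\<^sub>2 s (hd xs) z \<and> covers F Y' {z}"
    using ys covers_trans by (metis list.sel(1))
qed

text \<open>A member of the front that is at least as good as \<open>x\<^sub>0\<close> cannot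
  dominate \<open>y\<close>. Used with the starting point to confine the iterates, and with a
  refined point to separate images.\<close>

lemma in_sublevel_if_covers:
  assumes "nondominated_front F Y" "covers F Y {x\<^sub>0}" "y \<in> Y"
  shows "\<exists>j. F y $ j \<le> F x\<^sub>0 $ j"
proof -
  obtain u where u: "u \<in> Y" "F u \<le> F x\<^sub>0"
    using assms(2) by (auto simp: covers_def)
  have "\<not> dominates F u y"
    using assms u by (auto simp: nondominated_front_def mutually_nondominated_def)
  then obtain j where "F y $ j \<le> F u $ j"
    by (auto simp: dominates_def less_eq_vec_def not_le intro: less_imp_le)
  with u(2) show ?thesis
    by (auto simp: less_eq_vec_def intro: order_trans)
qed

text \<open>Some component of \<open>F q\<close> is at most that of \<open>F z\<close>, hence at
  least \<open>c\<close> below that of \<open>F p\<close>.\<close>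

lemma covers_gap:
  fixes F :: "'a \<Rightarrow> real ^ 'm"
  assumes "nondominated_front F Y" "covers F Y {z}" "F z \<le> F p - vec c" "q \<in> Y"
  shows "c \<le> dist (F p) (F q)"
proof -
  obtain j where "F q $ j \<le> F z $ j"
    using in_sublevel_if_covers[OF assms(1,2,4)] by blast
  then have "c \<le> (F p - F q) $ j"
    using assms(3)[unfolded less_eq_vec_def, rule_format, of j] by simp
  also have "\<dots> \<le> dist (F p) (F q)"
    using component_le_norm_cart[of "F p - F q" j] by (simp add: dist_norm)
  finally show ?thesis .
qed

subsection \<open>Convergence\<close>

text \<open>The packing argument, isolated from the algorithm: a run enters only through
  nondominated fronts, their monotonicity under \<open>covers\<close>, and the refinement of one
  point \<open>p k\<close> per iteration.\<close>

lemma theta_argmin_tendsto: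
  fixes F :: "real ^ 'n \<Rightarrow> real ^ 'm"
  assumes ass: "continuously_differentiable F" "0 < \<alpha>\<^sub>0" "0 < \<delta>" "\<delta> < 1" "0 < \<gamma>" "\<gamma> < 1"
      "0 < \<Gamma>\<^sub>1" "0 < \<Gamma>\<^sub>2"
    and \<sigma>: "\<sigma> \<longlonglongrightarrow> 0" and L: "compact L"
    and p: "\<And>k. p k \<in> X k" "\<And>k. p k \<in> L"
    and nd: "\<And>k. nondominated_front F (X k)" and mono: "\<And>i j. i \<le> j \<Longrightarrow> covers F (X j) (X i)"
    and step: "\<And>k. \<exists>z. refinement F \<alpha>\<^sub>0 \<delta> \<gamma> \<Gamma>\<^sub>1 \<Gamma>\<^sub>2 (\<sigma> k) (p k) z \<and> covers F (X (Suc k)) {z}"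
  shows "(\<lambda>k. theta F UNIV (p k)) \<longlonglongrightarrow> 0"
proof (rule order_tendstoI)
  fix a :: real assume "0 < a"
  then show "\<forall>\<^sub>F k in sequentially. theta F UNIV (p k) < a"
    by (intro always_eventually allI le_less_trans[OF theta_nonpos]) auto
next
  fix a :: real assume "a < 0"
  define \<epsilon> where "\<epsilon> = - a"
  have \<epsilon>: "0 < \<epsilon>" "a = - \<epsilon>"
    using \<open>a < 0\<close> by (auto simp: \<epsilon>_def)
  obtain c where c: "0 < c" and gain: "\<And>s x z. \<lbrakk>x \<in> L; s < \<epsilon>; theta F UNIV x \<le> - \<epsilon>;
      refinement F \<alpha>\<^sub>0 \<delta> \<gamma> \<Gamma>\<^sub>1 \<Gamma>\<^sub>2 s x z\<rbrakk> \<Longrightarrow> F z \<le> F x - vec c"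
    using refinement_gain[OF ass L \<epsilon>(1)] by blast
  \<comment> \<open>The indices at which a gain of \<open>c\<close> is guaranteed. As
    \<open>\<sigma> k < \<epsilon>\<close> eventually, finiteness of \<open>B\<close>
    suffices.\<close>
  define B where "B = {k. theta F UNIV (p k) \<le> - \<epsilon> \<and> \<sigma> k < \<epsilon>}"
  have gap: "c \<le> dist (F (p i)) (F (p j))" if "i \<in> B" "i < j" for i j
  proof -
    obtain z where z: "refinement F \<alpha>\<^sub>0 \<delta> \<gamma> \<Gamma>\<^sub>1 \<Gamma>\<^sub>2 (\<sigma> i) (p i) z" "covers F (X (Suc i)) {z}"
      using step by blast
    have "F z \<le> F (p i) - vec c"
      using gain[OF p(2) _ _ z(1)] that by (simp add: B_def)
    \<comment> \<open>The refined point is covered from \<open>X (Suc i)\<close> on, and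
      \<open>i < j\<close> means \<open>Suc i \<le> j\<close>.\<close>
    moreover have "covers F (X j) {z}"
      using that by (intro covers_trans[OF mono z(2)]) simp
    ultimately show ?thesis
      using covers_gap[OF nd _ _ p(1)] by blast
  qed
  have "finite B"
  proof (rule ccontr)
    assume "infinite B"
    then obtain r :: "nat \<Rightarrow> nat" where r: "strict_mono r" "\<And>n. r n \<in> B"
      using infinite_enumerate by blast
    have "continuous_on L F"
      using ass(1) unfolding continuously_differentiable_def
      by (blast intro: differentiable_imp_continuous_on continuous_on_subset[OF _ subset_UNIV])
    then have "compact (F ` L)"
      using L by (rule compact_continuous_image)
    moreover have "\<forall>n. F (p (r n)) \<in> F ` L"
      using p(2) by blast
    ultimately have "\<exists>l\<in>F ` L. \<exists>s. strict_mono s \<and> ((\<lambda>n. F (p (r n))) \<circ> s) \<longlonglongrightarrow> l"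
      by (simp add: compact_def)
    then obtain l s where s: "strict_mono s" "((\<lambda>n. F (p (r n))) \<circ> s) \<longlonglongrightarrow> l"
      by blast
    \<comment> \<open>A convergent subsequence of images is Cauchy, so two consecutive late terms
      violate the gap \<open>c\<close>.\<close>
    from LIMSEQ_imp_Cauchy[OF s(2)] c
    obtain N where "\<forall>m\<ge>N. \<forall>n\<ge>N. dist (F (p (r (s m)))) (F (p (r (s n)))) < c"
      unfolding Cauchy_def comp_def by blast
    then have "dist (F (p (r (s N)))) (F (p (r (s (Suc N))))) < c"
      by simp
    moreover have "r (s N) < r (s (Suc N))"
      using r(1) s(1) by (simp add: strict_mono_def)
    ultimately show False
      using gap[OF r(2), of "s N" "r (s (Suc N))"] by simp
  qed
  then have "\<forall>\<^sub>F k in sequentially. k \<notin> B"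
    by (simp add: eventually_cofinite flip: cofinite_eq_sequentially)
  moreover have "\<forall>\<^sub>F k in sequentially. \<sigma> k < \<epsilon>"
    using \<sigma> \<epsilon>(1) by (rule order_tendstoD)
  ultimately show "\<forall>\<^sub>F k in sequentially. a < theta F UNIV (p k)"
    by eventually_elim (auto simp: B_def \<epsilon>(2))
qed

text \<open>For each fixed \<open>d\<close> the model at \<open>x k\<close> lies above
  \<open>theta\<close>, so its limit, the model at \<open>l\<close>, is nonnegative.\<close>

lemma pareto_stationary_limit:
  fixes F :: "real ^ 'n \<Rightarrow> real ^ 'm"
  assumes F: "continuously_differentiable F" and x: "x \<longlonglongrightarrow> l"
    and \<theta>: "(\<lambda>k. theta F UNIV (x k)) \<longlonglongrightarrow> 0"
  shows "pareto_stationary F l"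
proof (rule pareto_stationary_if_theta_nonneg)
  have "0 \<le> descent_model F UNIV l d" for d
  proof (rule LIMSEQ_le[OF \<theta>])
    show "(\<lambda>k. descent_model F UNIV (x k) d) \<longlonglongrightarrow> descent_model F UNIV l d"
      using F x by (intro tendsto_descent_model) auto
  qed (auto intro: theta_le)
  then show "0 \<le> theta F UNIV l"
    using F by (simp add: theta_eq_descent_model_steepest)
qed

theorem corollary5p18:
  fixes F :: "real ^ 'n \<Rightarrow> real ^ 'm"
    and \<alpha>\<^sub>0 \<delta> \<gamma> \<Gamma>\<^sub>1 \<Gamma>\<^sub>2 :: real
    and \<sigma> :: "nat \<Rightarrow> real"
    and X :: "nat \<Rightarrow> (real ^ 'n) set"
    and ord :: "nat \<Rightarrow> (real ^ 'n) list"
    and x\<^sub>0 :: "real ^ 'n"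
    and x :: "nat \<Rightarrow> real ^ 'n"
  assumes "continuously_differentiable F"
    and "\<alpha>\<^sub>0 > 0" and "0 < \<delta>" and "\<delta> < 1" and "0 < \<gamma>" and "\<gamma> < 1"
    and "\<Gamma>\<^sub>1 > 0" and "\<Gamma>\<^sub>2 > 0"
    and "\<And>k. \<sigma> k \<ge> 0" and "\<sigma> \<longlonglongrightarrow> 0"
    and "finite (X 0)" and "X 0 \<noteq> {}" and "mutually_nondominated F (X 0)"
    and "x\<^sub>0 \<in> X 0"
    and "compact (\<Union>j. {y. F y $ j \<le> F x\<^sub>0 $ j})"
    and "\<And>k. front_descent_iteration F \<alpha>\<^sub>0 \<delta> \<gamma> \<Gamma>\<^sub>1 \<Gamma>\<^sub>2 (\<sigma> k) (ord k) (X k) (X (Suc k))"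
    and "\<And>k. is_arg_min (theta F UNIV) (\<lambda>y. y \<in> X k) (hd (ord k))"
    and "\<And>k. x k \<in> X k"
  shows "(\<exists>l. accumulation_point x l) \<and>
         (\<forall>l. accumulation_point x l \<longrightarrow> pareto_stationary F l)"
proof -
  note ass = assms(1-8)
  define L where "L = (\<Union>j. {y. F y $ j \<le> F x\<^sub>0 $ j})"
  have L: "compact L"
    using assms(15) by (simp add: L_def)
  have nd: "nondominated_front F (X k)" for k
  proof (induction k)
    case (Suc k)
    then show ?case
      by (rule front_descent_iteration(1)[OF ass assms(9) _ assms(16)])
  qed (use assms in \<open>simp add: nondominated_front_def\<close>)
  have mono: "covers F (X j) (X i)" if "i \<le> j" for i j
    using that
  proof (induction j rule: dec_induct)
    case (step k)
    then show ?case
      using front_descent_iteration(2)[OF ass assms(9) nd assms(16)] covers_trans by blast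
  qed simp
  \<comment> \<open>The initial point \<open>x\<^sub>0\<close> stays covered, which confines every
    front to the compact set \<open>L\<close>.\<close>
  have XL: "y \<in> L" if "y \<in> X k" for y k
  proof -
    have "covers F (X k) {x\<^sub>0}"
      using mono[of 0 k] assms(14) by (auto simp: covers_def)
    from in_sublevel_if_covers[OF nd this that] show ?thesis
      by (auto simp: L_def)
  qed
  have argmin: "hd (ord k) \<in> X k" "theta F UNIV (hd (ord k)) \<le> theta F UNIV y" if "y \<in> X k" for k y
    using assms(17)[of k] that by (auto simp: is_arg_min_def not_less)
  have "(\<lambda>k. theta F UNIV (hd (ord k))) \<longlonglongrightarrow> 0"
  proof (rule theta_argmin_tendsto[OF ass assms(10) L _ _ nd mono])
    show "\<exists>z. refinement F \<alpha>\<^sub>0 \<delta> \<gamma> \<Gamma>\<^sub>1 \<Gamma>\<^sub>2 (\<sigma> k) (hd (ord k)) z \<and> covers F (X (Suc k)) {z}" for k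
      using assms(18)[of k] by (intro front_descent_iteration(3)[OF ass assms(9) nd assms(16)]) auto
  qed (use argmin(1)[OF assms(18)] XL in auto)
  \<comment> \<open>By minimality \<open>theta\<close> at \<open>x k\<close> lies between its value
    at the first processed point and 0.\<close>
  from tendsto_sandwich[OF _ _ this tendsto_const]
  have \<theta>: "(\<lambda>k. theta F UNIV (x k)) \<longlonglongrightarrow> 0"
    by (simp add: argmin(2)[OF assms(18)] theta_nonpos)
  have "\<exists>l. accumulation_point x l"
    using L XL[OF assms(18)] unfolding compact_def accumulation_point_def by blast
  moreover have "pareto_stationary F l" if l: "accumulation_point x l" for l
  proof -
    obtain r where r: "strict_mono r" "(x \<circ> r) \<longlonglongrightarrow> l"
      using l by (auto simp: accumulation_point_def)
    have "(\<lambda>k. theta F UNIV ((x \<circ> r) k)) \<longlonglongrightarrow> 0"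
      using LIMSEQ_subseq_LIMSEQ[OF \<theta> r(1)] by (simp add: comp_def)
    with r(2) show ?thesis
      by (rule pareto_stationary_limit[OF assms(1)])
  qed
  ultimately show ?thesis by blast
qed

end
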